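(* Let $d\ge2$ be an integer. For $r,\varepsilon>0$ with $\varepsilon\le re^r$ let $(N^*,m^* )=(N^*(\varepsilon,r),m^*(\varepsilon,r))$ be the unique solution of $$\text{minimise } m\,\frac{d^{N+1}}{(d-1)N}\ \text{ over } (N,m)\in(0,\infty)^2\quad\text{subject to } \frac{r^{N+1}e^r}{(N+1)!\,m^N}=\varepsilon ,$$ and let $\lambda(\varepsilon,r):=\log(re^r/\varepsilon)$. Then $N^*$ is strictly increasing as $r$ increases and as $\varepsilon$ decreases, and $$N^*\sim\sqrt{\frac{\lambda(\varepsilon,r)}{\log d}},\qquad m^*\sim r\sqrt{\frac{\log d}{\lambda(\varepsilon,r)}}\,\exp\Big(\sqrt{\lambda(\varepsilon,r)\log d}\Big)$$ as $r\to+\infty$ with $\varepsilon$ fixed, and as $\varepsilon\to0^+$ with $r$ fixed.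
   Context: $N$ and $m$ are real variables, and $(N+1)!:=\Gamma(N+2)$ for real $N>0$. For $\varepsilon\le re^r$ the problem of minimising $m\,\frac{d^{N+1}}{(d-1)N}$ over $(N,m)\in(0,\infty)^2$ subject to $\frac{r^{N+1}e^r}{(N+1)!\,m^N}=\varepsilon$ has a unique solution: $N^*$ is the unique minimiser on $(0,\infty)$ of the strictly convex function $\phi(N)=\frac{d^{N+1}}{(d-1)N}\big(\frac{e^r r^{N+1}}{\varepsilon (N+1)!}\big)^{1/N}$, and $m^*=\big(\frac{e^r r^{N^*+1}}{\varepsilon (N^*+1)!}\big)^{1/N^*}$. The notation $a\sim b$ means $a/b\to1$ in the stated limit. *)

theory Defs
  imports "HOL-Analysis.Analysis" "HOL-Library.Landau_Symbols"
begin

(* N and m are real, so (N+1)! is Gamma (N+2), and all powers are real powers;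
   their bases d, r, m are positive wherever the definitions are used. *)

definition cost :: "nat \<Rightarrow> real \<times> real \<Rightarrow> real" where
  "cost d = (\<lambda>(N, m). m * (real d powr (N + 1) / ((real d - 1) * N)))"

definition feasible :: "real \<Rightarrow> real \<Rightarrow> real \<times> real \<Rightarrow> bool" where
  "feasible \<epsilon> r = (\<lambda>(N, m). N > 0 \<and> m > 0 \<and>
     r powr (N + 1) * exp r / (Gamma (N + 2) * m powr N) = \<epsilon>)"

definition is_optimal :: "nat \<Rightarrow> real \<Rightarrow> real \<Rightarrow> real \<times> real \<Rightarrow> bool" where
  "is_optimal d \<epsilon> r = is_arg_min (cost d) (feasible \<epsilon> r)"

(* Meaningful when there is exactly one optimal pair, in particular for
   0 < r and 0 < \<epsilon> \<le> r * exp r. *)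
definition N_star :: "nat \<Rightarrow> real \<Rightarrow> real \<Rightarrow> real" where
  "N_star d \<epsilon> r = fst (THE p. is_optimal d \<epsilon> r p)"

definition m_star :: "nat \<Rightarrow> real \<Rightarrow> real \<Rightarrow> real" where
  "m_star d \<epsilon> r = snd (THE p. is_optimal d \<epsilon> r p)"

definition lam :: "real \<Rightarrow> real \<Rightarrow> real" where
  "lam \<epsilon> r = ln (r * exp r / \<epsilon>)"

end

theory Submission
  imports Defs "HOL-Real_Asymp.Real_Asymp"
begin

text \<open>
  Write $c = \ln d$, $\lambda = \lambda(\varepsilon, r)$ and $G(N) = \ln\Gamma(N+2)$. Solving the
  constraint for $m$ gives $m = r \exp((\lambda - G(N))/N)$, so the cost of a feasible pair is a
  positive constant times $\exp(h(N))$ with $h(N) = (\lambda - G(N))/N + cN - \ln N$. The derivative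
  is $h'(N) = (F(N) - \lambda)/N^2$, where $F(N) = G(N) - N G'(N) + cN^2 - N$ depends neither on
  $r$ nor on $\varepsilon$.

  The function $F$ vanishes at $0$, and
  $F'(N) = N(2c - \psi'(N+2)) - 1$ is strictly increasing, because the trigamma function $\psi'$
  is decreasing and $\psi'(N+2) < 1 < 2c$. Hence $F$ is strictly convex, and it is strictly
  increasing from any positive point where it is nonnegative
  (\<open>crit_strict_mono\<close>). For $\lambda \ge 0$ the equation $F(N) = \lambda$ therefore has exactly one
  positive solution; $h$ decreases before it and increases after it, so it is the minimiser
  $N^*$ (\<open>is_optimal_iff\<close>). In particular $N^*$ is a strictly increasing function of $\lambda$,
  and $\lambda$ increases with $r$ and decreases with $\varepsilon$.

  For the asymptotics, the bounds $1/x \le \psi'(x) \le 1/(x-1)$ integrate to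
  $cN^2 - 2N \le F(N) \le cN^2 - 2N + 2\ln(1 + N/2)$ (\<open>crit_bounds\<close>). So
  $\lambda = F(N^*) \sim c (N^*)^2$. Substituting $\lambda = F(N^*)$ in the formula for $m$ gives
  $m^* = r\exp(cN^* - 1 - \psi(N^*+2))$. Here $\exp(-\psi(N+2)) \sim 1/N$, while
  $cF(N) = (cN-1)^2 + O(\ln N)$ gives $\sqrt{cF(N)} = cN - 1 + o(1)$, which is precise enough to be
  exponentiated. Both limits in the theorem are instances of $\lambda \to \infty$.
\<close>

section \<open>Elementary bounds for the digamma and trigamma functions\<close>

text \<open>The series of $\psi'(x) = \sum_k (x+k)^{-2}$ lies termwise between the telescoping series
  $\sum_k 1/((x+k)(x+k+1))$ and $\sum_k 1/((x+k-1)(x+k))$.\<close>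

lemma trigamma_bounds:
  fixes x :: real
  assumes "x > 1"
  shows "1 / x \<le> Polygamma 1 x" "Polygamma 1 x \<le> 1 / (x - 1)"
proof -
  have S: "(\<lambda>k. inverse ((x + real k)\<^sup>2)) sums Polygamma 1 x"
    using Polygamma_LIMSEQ[of x 1] assms by (simp add: power2_eq_square)
  have L: "(\<lambda>k. inverse (y + real k)) \<longlonglongrightarrow> 0" for y :: real
    by real_asymp
  have T: "(\<lambda>k. inverse (y + real k) - inverse (y + real (Suc k))) sums (1 / y)" for y :: real
    using telescope_sums'[OF L[of y]] by (simp add: field_simps)
  have le: "inverse (x + real k) - inverse (x + real (Suc k)) \<le> inverse ((x + real k)\<^sup>2)"
    (is "?l \<le> ?r") for k
  proof -
    have "?l = 1 / ((x + real k) * (x + real k + 1))"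
      using assms by (simp add: field_simps)
    also have "\<dots> \<le> 1 / ((x + real k) * (x + real k))"
      using assms by (intro divide_left_mono mult_left_mono mult_pos_pos) auto
    finally show ?thesis by (simp add: power2_eq_square inverse_eq_divide)
  qed
  show "1 / x \<le> Polygamma 1 x"
    by (rule sums_le[OF le T S])
  have ge: "inverse ((x + real k)\<^sup>2) \<le> inverse (x - 1 + real k) - inverse (x - 1 + real (Suc k))"
    (is "?l \<le> ?r") for k
  proof -
    have "?l = 1 / ((x + real k) * (x + real k))"
      by (simp add: power2_eq_square inverse_eq_divide)
    also have "\<dots> \<le> 1 / ((x + real k - 1) * (x + real k))"
      using assms by (intro divide_left_mono mult_right_mono mult_pos_pos) auto
    also have "\<dots> = ?r"
      using assms by (simp add: field_simps)
    finally show ?thesis .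
  qed
  show "Polygamma 1 x \<le> 1 / (x - 1)"
    by (rule sums_le[OF ge S T])
qed

text \<open>By the mean value theorem $\ln y = \ln\Gamma(y+1) - \ln\Gamma(y)$ is a value of $\psi$ in
  $(y, y+1)$, and $\psi$ is increasing.\<close>

lemma Digamma_bounds:
  fixes x :: real
  assumes "x > 1"
  shows "ln (x - 1) \<le> Digamma x" "Digamma x \<le> ln x"
proof -
  have *: "\<exists>\<xi>. y < \<xi> \<and> \<xi> < y + 1 \<and> ln y = Digamma \<xi>" if "y > 0" for y :: real
  proof -
    have "\<exists>\<xi>>y. \<xi> < y + 1 \<and> ln_Gamma (y + 1) - ln_Gamma y = (y + 1 - y) * Digamma \<xi>"
      using that by (intro MVT2 has_field_derivative_ln_Gamma_real) auto
    moreover have "ln_Gamma (y + 1) - ln_Gamma y = ln y"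
    proof -
      have "y \<notin> \<int>\<^sub>\<le>\<^sub>0"
        using that by (auto elim!: nonpos_Ints_cases)
      then show ?thesis
        using that Gamma_plus1[of y]
        by (simp add: ln_Gamma_real_pos ln_mult Gamma_eq_zero_iff)
    qed
    ultimately show ?thesis by auto
  qed
  obtain \<xi> where "x - 1 < \<xi>" "\<xi> < x" "ln (x - 1) = Digamma \<xi>"
    using *[of "x - 1"] assms by auto
  then show "ln (x - 1) \<le> Digamma x"
    using Digamma_real_mono[of \<xi> x] assms by simp
  obtain \<xi> where "x < \<xi>" "ln x = Digamma \<xi>"
    using *[of x] assms by auto
  then show "Digamma x \<le> ln x"
    using Digamma_real_mono[of x \<xi>] assms by simp
qed

section \<open>The equation characterising the optimal exponent\<close>

text \<open>The function $F$ whose equation $F(N) = \lambda$ expresses that $N$ is a critical point of the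
  logarithmic cost; the parameter \<open>c\<close> stands for $\ln d$.\<close>

definition crit :: "real \<Rightarrow> real \<Rightarrow> real" where
  "crit c x = ln_Gamma (x + 2) - x * Digamma (x + 2) + c * x\<^sup>2 - x"

lemma has_field_derivative_crit:
  assumes "x \<ge> 0"
  shows "(crit c has_field_derivative x * (2 * c - Polygamma 1 (x + 2)) - 1) (at x)"
proof -
  have "x + 2 \<notin> \<int>\<^sub>\<le>\<^sub>0"
    using assms by (auto elim!: nonpos_Ints_cases)
  then show ?thesis
    unfolding crit_def using assms
    by (auto intro!: derivative_eq_intros simp: algebra_simps)
qed

lemma crit_0: "crit c 0 = 0"
  by (simp add: crit_def ln_Gamma_real_pos Gamma_numeral)

lemma crit_bounds:
  assumes "x \<ge> 0"
  shows "c * x\<^sup>2 - 2 * x \<le> crit c x"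
    and "crit c x \<le> c * x\<^sup>2 - 2 * x + 2 * ln (1 + x / 2)"
proof -
  define l where "l = (\<lambda>y. crit c y - (c * y\<^sup>2 - 2 * y))"
  define u where "u = (\<lambda>y. c * y\<^sup>2 - 2 * y + 2 * ln (1 + y / 2) - crit c y)"
  have "l 0 \<le> l x"
  proof (rule DERIV_nonneg_imp_nondecreasing[OF assms])
    fix y :: real assume y: "0 \<le> y" "y \<le> x"
    have "y * Polygamma 1 (y + 2) \<le> y * (1 / (y + 1))"
      using trigamma_bounds(2)[of "y + 2"] y
      by (intro mult_left_mono) (auto simp: add.commute)
    also have "\<dots> \<le> 1"
      using y by (simp add: field_simps)
    finally have "1 - y * Polygamma 1 (y + 2) \<ge> 0" by simp
    moreover have "(l has_field_derivative 1 - y * Polygamma 1 (y + 2)) (at y)"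
      unfolding l_def using y
      by (auto intro!: derivative_eq_intros has_field_derivative_crit simp: algebra_simps)
    ultimately show "\<exists>D. (l has_real_derivative D) (at y) \<and> 0 \<le> D" by blast
  qed
  then show "c * x\<^sup>2 - 2 * x \<le> crit c x"
    by (simp add: l_def crit_0)
  have "u 0 \<le> u x"
  proof (rule DERIV_nonneg_imp_nondecreasing[OF assms])
    fix y :: real assume y: "0 \<le> y" "y \<le> x"
    have "y * Polygamma 1 (y + 2) \<ge> y * (1 / (y + 2))"
      using trigamma_bounds(1)[of "y + 2"] y by (intro mult_left_mono) auto
    then have "2 / (y + 2) - 1 + y * Polygamma 1 (y + 2) \<ge> 0"
      using y by (simp add: field_simps)
    moreover have "(u has_field_derivative 2 / (y + 2) - 1 + y * Polygamma 1 (y + 2)) (at y)"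
      unfolding u_def using y
      by (auto intro!: derivative_eq_intros has_field_derivative_crit simp: field_simps)
    ultimately show "\<exists>D. (u has_real_derivative D) (at y) \<and> 0 \<le> D" by blast
  qed
  then show "crit c x \<le> c * x\<^sup>2 - 2 * x + 2 * ln (1 + x / 2)"
    by (simp add: u_def crit_0)
qed

text \<open>$F$ may decrease near $0$, but by strict convexity it increases strictly once it has returned
  to its value $0$ at the origin.\<close>

lemma crit_strict_mono:
  assumes "c > 1/2" "0 < x" "x < y" "0 \<le> crit c x"
  shows "crit c x < crit c y"
proof -
  define D where "D = (\<lambda>z. z * (2 * c - Polygamma 1 (z + 2)) - 1)"
  have D: "(crit c has_field_derivative D z) (at z)" if "z \<ge> 0" for z
    using has_field_derivative_crit[OF that] by (simp add: D_def)
  \<comment> \<open>A point before \<open>x\<close> has nonnegative slope, so all slopes beyond \<open>x\<close> are positive.\<close>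
  have "\<exists>z. 0 < z \<and> z < x \<and> crit c x - crit c 0 = (x - 0) * D z"
    using assms by (intro MVT2 D) auto
  then obtain z where z: "0 < z" "z < x" "crit c x = x * D z"
    by (auto simp: crit_0)
  have "\<exists>w. x < w \<and> w < y \<and> crit c y - crit c x = (y - x) * D w"
    using assms by (intro MVT2 D) auto
  then obtain w where w: "x < w" "w < y" "crit c y - crit c x = (y - x) * D w"
    by auto
  have "0 \<le> D z"
    using z assms by (simp add: zero_le_mult_iff)
  have "Polygamma 1 (z + 2) \<le> 1 / (z + 1)"
    using trigamma_bounds(2)[of "z + 2"] z by (simp add: add.commute)
  also have "\<dots> < 1"
    using z by simp
  finally have "0 < 2 * c - Polygamma 1 (z + 2)"
    using assms by simp
  moreover have "Polygamma 1 (w + 2) < Polygamma 1 (z + 2)"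
    using z w by (intro Polygamma_real_strict_antimono) auto
  ultimately have "D z < D w"
    using z w unfolding D_def by (intro diff_strict_right_mono mult_strict_mono) auto
  with \<open>0 \<le> D z\<close> have "0 < (y - x) * D w"
    using assms by simp
  with w show ?thesis by simp
qed

lemma crit_less_iff:
  assumes "c > 1/2" "0 < x" "0 < y" "0 \<le> crit c x" "0 \<le> crit c y"
  shows "crit c x < crit c y \<longleftrightarrow> x < y"
  using crit_strict_mono[of c x y] crit_strict_mono[of c y x] assms
  by (cases x y rule: linorder_cases) auto

lemma ex_crit_eq:
  assumes "c > 1/2" "0 \<le> l"
  shows "\<exists>x>0. crit c x = l"
proof -
  \<comment> \<open>The upper bound in \<open>crit_bounds\<close> is at most $cx^2 - x$, which vanishes at \<open>a\<close>; the lower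
    bound is $x (cx - 2)$, which is at least \<open>l\<close> at \<open>b\<close> because there $cb - 2 \ge l$ and
    $b \ge 1$.\<close>
  define a where "a = 1 / c"
  define b where "b = (l + 2) / c + 1"
  have "a > 0" "a \<le> b"
    using assms by (auto simp: a_def b_def field_simps)
  have "crit c a \<le> c * a\<^sup>2 - 2 * a + 2 * ln (1 + a / 2)"
    using \<open>a > 0\<close> by (intro crit_bounds) auto
  also have "\<dots> \<le> c * a\<^sup>2 - 2 * a + 2 * (a / 2)"
    using ln_add_one_self_le_self[of "a / 2"] \<open>a > 0\<close> by simp
  also have "\<dots> = 0"
    using assms by (simp add: a_def power2_eq_square)
  finally have "crit c a \<le> l"
    using assms by simp
  have "b \<ge> 1"
    using assms by (simp add: b_def)
  have "l \<le> b * l"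
    using \<open>b \<ge> 1\<close> assms mult_right_mono[of 1 b l] by simp
  also have "\<dots> \<le> b * (c * b - 2)"
    using \<open>b \<ge> 1\<close> assms by (intro mult_left_mono) (auto simp: b_def field_simps)
  also have "\<dots> = c * b\<^sup>2 - 2 * b"
    by (simp add: power2_eq_square algebra_simps)
  also have "\<dots> \<le> crit c b"
    using \<open>b \<ge> 1\<close> by (intro crit_bounds) auto
  finally have "l \<le> crit c b" .
  have "\<exists>x\<ge>a. x \<le> b \<and> crit c x = l"
    using \<open>crit c a \<le> l\<close> \<open>l \<le> crit c b\<close> \<open>a \<le> b\<close> \<open>a > 0\<close>
    by (intro IVT) (auto intro: DERIV_isCont[OF has_field_derivative_crit])
  with \<open>a > 0\<close> show ?thesis by (metis less_le_trans)
qed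

section \<open>Solution of the optimisation problem\<close>

text \<open>The logarithm $h(N)$ of the cost of the feasible pair with exponent $N$, up to an additive
  constant independent of $N$; here \<open>c\<close> stands for $\ln d$ and \<open>l\<close> for $\lambda$.\<close>

definition log_cost :: "real \<Rightarrow> real \<Rightarrow> real \<Rightarrow> real" where
  "log_cost c l N = (l - ln_Gamma (N + 2)) / N + c * N - ln N"

lemma has_field_derivative_log_cost:
  assumes "N > 0"
  shows "(log_cost c l has_field_derivative (crit c N - l) / N\<^sup>2) (at N)"
  unfolding log_cost_def crit_def using assms
  by (auto intro!: derivative_eq_intros simp: field_simps power2_eq_square)

lemma log_cost_strict_min:
  assumes "c > 1/2" "0 < N" "crit c N = l" "0 \<le> l" "0 < M" "M \<noteq> N"
  shows "log_cost c l N < log_cost c l M"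
proof -
  have cont: "continuous_on {x..y} (log_cost c l)" if "0 < x" for x y
    using that
    by (intro continuous_at_imp_continuous_on ballI DERIV_isCont[OF has_field_derivative_log_cost])
       auto
  show ?thesis
  proof (cases "N < M")
    case True
    show ?thesis
    proof (rule DERIV_pos_imp_increasing_open[OF True])
      fix x assume x: "N < x" "x < M"
      with assms have "crit c N < crit c x"
        by (intro crit_strict_mono) auto
      with x assms have "(crit c x - l) / x\<^sup>2 > 0" by simp
      with x assms show "\<exists>D. (log_cost c l has_real_derivative D) (at x) \<and> 0 < D"
        using has_field_derivative_log_cost[of x c l] by auto
    qed (use assms cont in auto)
  next
    case False
    with assms have less: "M < N" by simp
    show ?thesis
    proof (rule DERIV_neg_imp_decreasing_open[OF less])
      fix x assume x: "M < x" "x < N"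
      have "crit c x < l"
        using crit_strict_mono[of c x N] x assms by fastforce
      with x assms have "(crit c x - l) / x\<^sup>2 < 0"
        by (simp add: divide_neg_pos)
      with x assms show "\<exists>D. (log_cost c l has_real_derivative D) (at x) \<and> D < 0"
        using has_field_derivative_log_cost[of x c l] by auto
    qed (use assms cont in auto)
  qed
qed

text \<open>The only value of $m$ that satisfies the constraint for a given $N > 0$, where \<open>l\<close> stands for
  $\lambda$.\<close>

definition feasible_m :: "real \<Rightarrow> real \<Rightarrow> real \<Rightarrow> real" where
  "feasible_m r l N = r * exp ((l - ln_Gamma (N + 2)) / N)"

lemma feasible_iff:
  assumes "r > 0" "\<epsilon> > 0"
  shows "feasible \<epsilon> r (N, m) \<longleftrightarrow> N > 0 \<and> m = feasible_m r (lam \<epsilon> r) N"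
proof (cases "N > 0 \<and> m > 0")
  case True
  then have N: "N > 0" and m: "m > 0" by auto
  have lam: "lam \<epsilon> r = ln r + r - ln \<epsilon>"
    using assms by (simp add: lam_def ln_mult ln_div)
  have "r powr (N + 1) * exp r / (Gamma (N + 2) * m powr N) =
      exp ((N + 1) * ln r + r - ln_Gamma (N + 2) - N * ln m)"
    using assms N m by (simp add: powr_def Gamma_real_pos_exp exp_add exp_diff)
  then have "feasible \<epsilon> r (N, m) \<longleftrightarrow>
      exp ((N + 1) * ln r + r - ln_Gamma (N + 2) - N * ln m) = exp (ln \<epsilon>)"
    using assms N m by (simp add: feasible_def)
  also have "\<dots> \<longleftrightarrow> ln m = ln r + (lam \<epsilon> r - ln_Gamma (N + 2)) / N"
    using N by (simp add: lam field_simps) argo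
  also have "\<dots> \<longleftrightarrow> m = exp (ln r + (lam \<epsilon> r - ln_Gamma (N + 2)) / N)"
    using m by (metis exp_ln ln_exp)
  also have "\<dots> \<longleftrightarrow> m = feasible_m r (lam \<epsilon> r) N"
    using assms by (simp add: feasible_m_def exp_add)
  finally show ?thesis using N by simp
next
  case False
  then show ?thesis
    using assms by (auto simp: feasible_def feasible_m_def)
qed

lemma cost_feasible_m:
  assumes "d \<ge> 2" "r > 0" "N > 0"
  shows "cost d (N, feasible_m r l N) =
    r * real d / (real d - 1) * exp (log_cost (ln (real d)) l N)"
proof -
  have "exp (log_cost (ln (real d)) l N) =
      exp ((l - ln_Gamma (N + 2)) / N) * real d powr N / N"
    using assms by (simp add: log_cost_def exp_add exp_diff powr_def mult.commute)
  then show ?thesis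
    using assms by (simp add: cost_def feasible_m_def powr_add)
qed

lemma lam_nonneg:
  assumes "0 < \<epsilon>" "\<epsilon> \<le> r * exp r"
  shows "0 \<le> lam \<epsilon> r"
  using assms by (simp add: lam_def)

lemma ln_real_gt_half:
  assumes "(d::nat) \<ge> 2"
  shows "ln (real d) > 1/2"
proof -
  have "1/2 < ln (2::real)" using ln2_ge_two_thirds by simp
  also have "\<dots> \<le> ln (real d)" using assms by simp
  finally show ?thesis .
qed

lemma is_optimal_iff:
  assumes "d \<ge> 2" "r > 0" "0 < \<epsilon>" "\<epsilon> \<le> r * exp r"
    and "0 < N" "crit (ln (real d)) N = lam \<epsilon> r"
  shows "is_optimal d \<epsilon> r p \<longleftrightarrow> p = (N, feasible_m r (lam \<epsilon> r) N)"
proof -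
  let ?q = "(N, feasible_m r (lam \<epsilon> r) N)"
  have q: "feasible \<epsilon> r ?q"
    using assms by (simp add: feasible_iff)
  have less: "cost d ?q < cost d y" if y: "feasible \<epsilon> r y" "y \<noteq> ?q" for y
  proof -
    obtain M where M: "M > 0" "y = (M, feasible_m r (lam \<epsilon> r) M)" "M \<noteq> N"
      using y assms by (cases y) (auto simp: feasible_iff)
    have "log_cost (ln (real d)) (lam \<epsilon> r) N < log_cost (ln (real d)) (lam \<epsilon> r) M"
      using assms M ln_real_gt_half lam_nonneg by (intro log_cost_strict_min) auto
    then show ?thesis
      using assms M by (simp add: cost_feasible_m mult_strict_left_mono divide_strict_right_mono)
  qed
  show ?thesis
    unfolding is_optimal_def is_arg_min_def using q less by (metis order_less_asym)
qed

lemma N_star_m_star: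
  assumes "d \<ge> 2" "r > 0" "0 < \<epsilon>" "\<epsilon> \<le> r * exp r"
  shows "\<exists>!p. is_optimal d \<epsilon> r p"
    and "N_star d \<epsilon> r > 0"
    and "crit (ln (real d)) (N_star d \<epsilon> r) = lam \<epsilon> r"
    and "m_star d \<epsilon> r = feasible_m r (lam \<epsilon> r) (N_star d \<epsilon> r)"
proof -
  obtain N where N: "N > 0" "crit (ln (real d)) N = lam \<epsilon> r"
    using ex_crit_eq[OF ln_real_gt_half[OF assms(1)] lam_nonneg[OF assms(3,4)]] by blast
  note opt = is_optimal_iff[OF assms N]
  show "\<exists>!p. is_optimal d \<epsilon> r p"
    by (simp add: opt)
  have "N_star d \<epsilon> r = N" "m_star d \<epsilon> r = feasible_m r (lam \<epsilon> r) N"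
    by (simp_all add: N_star_def m_star_def opt)
  with N show "N_star d \<epsilon> r > 0" "crit (ln (real d)) (N_star d \<epsilon> r) = lam \<epsilon> r"
    "m_star d \<epsilon> r = feasible_m r (lam \<epsilon> r) (N_star d \<epsilon> r)"
    by simp_all
qed

lemma N_star_less_iff:
  assumes "d \<ge> 2" "r > 0" "0 < \<epsilon>" "\<epsilon> \<le> r * exp r" "r' > 0" "0 < \<epsilon>'" "\<epsilon>' \<le> r' * exp r'"
  shows "N_star d \<epsilon> r < N_star d \<epsilon>' r' \<longleftrightarrow> lam \<epsilon> r < lam \<epsilon>' r'"
  using crit_less_iff[of "ln (real d)" "N_star d \<epsilon> r" "N_star d \<epsilon>' r'"]
    ln_real_gt_half[of d] assms
  by (simp add: N_star_m_star lam_nonneg)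

section \<open>Asymptotics as the optimal exponent tends to infinity\<close>

lemma asymp_equiv_sqrt_crit:
  assumes "c > 0"
  shows "(\<lambda>x. x) \<sim>[at_top] (\<lambda>x. sqrt (crit c x / c))"
proof -
  have l: "(\<lambda>x. x) \<sim>[at_top] (\<lambda>x. sqrt ((c * x\<^sup>2 - 2 * x) / c))"
    using assms by real_asymp
  have u: "(\<lambda>x. x) \<sim>[at_top] (\<lambda>x. sqrt ((c * x\<^sup>2 - 2 * x + 2 * ln (1 + x / 2)) / c))"
    using assms by real_asymp
  show ?thesis
  proof (rule asymp_equiv_sandwich_real'[OF l u])
    show "eventually (\<lambda>x. sqrt (crit c x / c) \<in>
      {sqrt ((c * x\<^sup>2 - 2 * x) / c)..sqrt ((c * x\<^sup>2 - 2 * x + 2 * ln (1 + x / 2)) / c)}) at_top"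
      using eventually_ge_at_top[of 0]
    proof eventually_elim
      case (elim x)
      then show ?case
        using crit_bounds[of x c] assms by (simp add: divide_right_mono)
    qed
  qed
qed

text \<open>For $x > 2/c$, $a = cx - 1$ and $b = c F(x)$ the bounds on $F$ give
  $|a^2 - b| \le 1 + 2c \ln(1 + x/2)$, and $|a - \sqrt b| \le |a^2 - b| / a$.\<close>

lemma tendsto_sqrt_crit:
  assumes "c > 0"
  shows "((\<lambda>x. c * x - 1 - sqrt (crit c x * c)) \<longlongrightarrow> 0) at_top"
proof (rule Lim_null_comparison)
  show "((\<lambda>x. (1 + 2 * c * ln (1 + x / 2)) / (c * x - 1)) \<longlongrightarrow> 0) at_top"
    using assms by real_asymp
  show "eventually (\<lambda>x. norm (c * x - 1 - sqrt (crit c x * c))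
      \<le> (1 + 2 * c * ln (1 + x / 2)) / (c * x - 1)) at_top"
    using eventually_gt_at_top[of "2 / c"]
  proof eventually_elim
    case (elim x)
    define a where "a = c * x - 1"
    define b where "b = crit c x * c"
    have "x > 0"
      using elim assms by (meson divide_pos_pos less_trans zero_less_numeral)
    have "a > 0"
      using elim assms by (simp add: a_def field_simps)
    have "0 \<le> x * (c * x - 2)"
      using elim assms \<open>x > 0\<close> by (simp add: field_simps)
    also have "\<dots> = c * x\<^sup>2 - 2 * x"
      by (simp add: power2_eq_square algebra_simps)
    also have "\<dots> \<le> crit c x"
      using \<open>x > 0\<close> by (intro crit_bounds) simp
    finally have "b \<ge> 0"
      using assms by (simp add: b_def)
    have a2: "a\<^sup>2 = (c * x\<^sup>2 - 2 * x) * c + 1"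
      by (simp add: a_def power2_eq_square algebra_simps)
    have "(c * x\<^sup>2 - 2 * x) * c \<le> b"
      and "b \<le> (c * x\<^sup>2 - 2 * x + 2 * ln (1 + x / 2)) * c"
      unfolding b_def using crit_bounds[of x c] \<open>x > 0\<close> assms
      by (intro mult_right_mono; simp)+
    moreover have "c * ln (1 + x / 2) \<ge> 0"
      using assms \<open>x > 0\<close> by simp
    ultimately have ab: "\<bar>a\<^sup>2 - b\<bar> \<le> 1 + 2 * c * ln (1 + x / 2)"
      unfolding a2 abs_le_iff by (simp add: algebra_simps)
    have "a\<^sup>2 - b = (a - sqrt b) * (a + sqrt b)"
      using \<open>b \<ge> 0\<close> by (simp add: algebra_simps power2_eq_square)
    then have "\<bar>a - sqrt b\<bar> * (a + sqrt b) = \<bar>a\<^sup>2 - b\<bar>"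
      using \<open>a > 0\<close> \<open>b \<ge> 0\<close> by (simp add: abs_mult)
    moreover have "\<bar>a - sqrt b\<bar> * a \<le> \<bar>a - sqrt b\<bar> * (a + sqrt b)"
      using \<open>b \<ge> 0\<close> by (intro mult_left_mono) auto
    ultimately have "\<bar>a - sqrt b\<bar> * a \<le> 1 + 2 * c * ln (1 + x / 2)"
      using ab by simp
    then show ?case
      using \<open>a > 0\<close> by (simp add: a_def b_def pos_le_divide_eq)
  qed
qed

lemma asymp_equiv_exp_Digamma: "(\<lambda>x. exp (- Digamma (x + 2))) \<sim>[at_top] (\<lambda>x::real. 1 / x)"
proof -
  have l: "(\<lambda>x::real. 1 / x) \<sim>[at_top] (\<lambda>x. 1 / (x + 2))"
    by real_asymp
  have u: "(\<lambda>x::real. 1 / x) \<sim>[at_top] (\<lambda>x. 1 / (x + 1))"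
    by real_asymp
  show ?thesis
  proof (rule asymp_equiv_symI, rule asymp_equiv_sandwich_real'[OF l u])
    show "eventually (\<lambda>x::real. exp (- Digamma (x + 2)) \<in> {1 / (x + 2)..1 / (x + 1)}) at_top"
      using eventually_gt_at_top[of 0]
    proof eventually_elim
      case (elim x)
      have "1 / (x + 2) = exp (- ln (x + 2))" "1 / (x + 1) = exp (- ln (x + 1))"
        using elim by (simp_all add: exp_minus inverse_eq_divide)
      then show ?case
        using Digamma_bounds[of "x + 2"] elim by (simp add: add.commute)
    qed
  qed
qed

text \<open>At the critical exponent $\ln\Gamma$ cancels from the formula for $m$.\<close>

lemma feasible_m_crit:
  assumes "N > 0"
  shows "feasible_m r (crit c N) N = r * exp (c * N - 1 - Digamma (N + 2))"
proof -
  have "(crit c N - ln_Gamma (N + 2)) / N = c * N - 1 - Digamma (N + 2)"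
    using assms by (simp add: crit_def field_simps power2_eq_square)
  then show ?thesis by (simp add: feasible_m_def)
qed

lemma asymp_equiv_exp_crit:
  assumes "c > 0"
  shows "(\<lambda>x. exp (c * x - 1 - Digamma (x + 2))) \<sim>[at_top]
    (\<lambda>x. sqrt (c / crit c x) * exp (sqrt (crit c x * c)))"
proof -
  have "((\<lambda>x. exp (c * x - 1 - sqrt (crit c x * c))) \<longlongrightarrow> exp 0) at_top"
    by (intro tendsto_intros tendsto_sqrt_crit assms)
  then have "((\<lambda>x. exp (c * x - 1) / exp (sqrt (crit c x * c))) \<longlongrightarrow> 1) at_top"
    by (simp add: exp_diff)
  then have e: "(\<lambda>x. exp (c * x - 1)) \<sim>[at_top] (\<lambda>x. exp (sqrt (crit c x * c)))"
    by (intro asymp_equivI') simp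
  have "(\<lambda>x. inverse x) \<sim>[at_top] (\<lambda>x. inverse (sqrt (crit c x / c)))"
    by (intro asymp_equiv_inverse asymp_equiv_sqrt_crit assms)
  then have "(\<lambda>x. 1 / x) \<sim>[at_top] (\<lambda>x. sqrt (c / crit c x))"
    by (simp add: real_sqrt_divide inverse_eq_divide)
  moreover have "exp (- Digamma (x + 2)) * exp (c * x - 1) = exp (c * x - 1 - Digamma (x + 2))"
    for x
    by (simp flip: exp_add)
  ultimately show ?thesis
    using asymp_equiv_mult[OF asymp_equiv_trans[OF asymp_equiv_exp_Digamma] e] by simp
qed

text \<open>The asymptotics hold along any filter on which $\lambda$ tends to infinity, whichever of
  $r$ and $\varepsilon$ drives it.\<close>

lemma N_star_m_star_asymp:
  fixes e r :: "'a \<Rightarrow> real"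
  assumes "d \<ge> 2"
    and ev: "eventually (\<lambda>t. 0 < r t \<and> 0 < e t) F"
    and lim: "filterlim (\<lambda>t. lam (e t) (r t)) at_top F"
  shows "(\<lambda>t. N_star d (e t) (r t)) \<sim>[F] (\<lambda>t. sqrt (lam (e t) (r t) / ln (real d)))"
    and "(\<lambda>t. m_star d (e t) (r t)) \<sim>[F] (\<lambda>t. r t * sqrt (ln (real d) / lam (e t) (r t)) *
            exp (sqrt (lam (e t) (r t) * ln (real d))))"
proof -
  define c where "c = ln (real d)"
  define N where "N = (\<lambda>t. N_star d (e t) (r t))"
  have c: "c > 0"
    using ln_real_gt_half[OF assms(1)] by (simp add: c_def)
  have ev': "eventually (\<lambda>t. 0 < N t \<and> crit c (N t) = lam (e t) (r t) \<and>
      m_star d (e t) (r t) = feasible_m (r t) (lam (e t) (r t)) (N t)) F"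
    using ev filterlim_at_top_dense[THEN iffD1, OF lim, rule_format, of 0]
  proof eventually_elim
    case (elim t)
    then have "e t \<le> r t * exp (r t)"
      by (simp add: lam_def field_simps zero_less_divide_iff)
    then show ?case
      using N_star_m_star[OF assms(1)] elim by (simp add: N_def c_def)
  qed
  \<comment> \<open>The relation $\lambda = F(N) \le cN^2$ forces \<open>N\<close> to infinity.\<close>
  have N: "filterlim N at_top F"
  proof -
    have "filterlim (\<lambda>t. sqrt (lam (e t) (r t) / c)) at_top F"
      by (rule filterlim_compose[OF _ lim]) (use c in real_asymp)
    then show ?thesis
    proof (rule filterlim_at_top_mono)
      show "eventually (\<lambda>t. sqrt (lam (e t) (r t) / c) \<le> N t) F"
        using ev'
      proof eventually_elim
        case (elim t)
        then have "lam (e t) (r t) \<le> c * (N t)\<^sup>2 - 2 * N t + 2 * ln (1 + N t / 2)"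
          using crit_bounds(2)[of "N t" c] by simp
        also have "\<dots> \<le> c * (N t)\<^sup>2"
          using elim ln_add_one_self_le_self[of "N t / 2"] by simp
        finally show ?case
          using c elim by (intro real_le_lsqrt) (auto simp: field_simps)
      qed
    qed
  qed
  have "(\<lambda>t. N t) \<sim>[F] (\<lambda>t. sqrt (crit c (N t) / c))"
    by (rule asymp_equiv_compose'[OF asymp_equiv_sqrt_crit[OF c] N])
  also have "\<dots> \<sim>[F] (\<lambda>t. sqrt (lam (e t) (r t) / c))"
    by (rule asymp_equiv_refl_ev) (use ev' in eventually_elim, simp)
  finally show "(\<lambda>t. N_star d (e t) (r t)) \<sim>[F] (\<lambda>t. sqrt (lam (e t) (r t) / ln (real d)))"
    by (simp add: N_def c_def)
  have "(\<lambda>t. m_star d (e t) (r t)) \<sim>[F]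
      (\<lambda>t. r t * exp (c * N t - 1 - Digamma (N t + 2)))"
  proof (rule asymp_equiv_refl_ev, use ev' in eventually_elim)
    case (elim t)
    then show ?case using feasible_m_crit[of "N t" "r t" c] by simp
  qed
  also have "\<dots> \<sim>[F] (\<lambda>t. r t * (sqrt (c / crit c (N t)) * exp (sqrt (crit c (N t) * c))))"
    by (intro asymp_equiv_mult asymp_equiv_refl
          asymp_equiv_compose'[OF asymp_equiv_exp_crit[OF c] N])
  also have "\<dots> \<sim>[F] (\<lambda>t. r t * sqrt (c / lam (e t) (r t)) * exp (sqrt (lam (e t) (r t) * c)))"
    by (rule asymp_equiv_refl_ev) (use ev' in eventually_elim, simp)
  finally show "(\<lambda>t. m_star d (e t) (r t)) \<sim>[F]
      (\<lambda>t. r t * sqrt (ln (real d) / lam (e t) (r t)) * exp (sqrt (lam (e t) (r t) * ln (real d))))"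
    by (simp add: c_def)
qed

section \<open>Monotonicity and asymptotics of the optimal pair\<close>

theorem theorem1p5:
  fixes d :: nat
  assumes "d \<ge> 2"
  shows
    "(\<forall>r \<epsilon>. 0 < r \<and> 0 < \<epsilon> \<and> \<epsilon> \<le> r * exp r \<longrightarrow> (\<exists>!p. is_optimal d \<epsilon> r p)) \<and>
     (\<forall>\<epsilon>>0. strict_mono_on {r. 0 < r \<and> \<epsilon> \<le> r * exp r} (\<lambda>r. N_star d \<epsilon> r)) \<and>
     (\<forall>r>0. strict_antimono_on {\<epsilon>. 0 < \<epsilon> \<and> \<epsilon> \<le> r * exp r} (\<lambda>\<epsilon>. N_star d \<epsilon> r)) \<and>
     (\<forall>\<epsilon>>0.
        (\<lambda>r. N_star d \<epsilon> r) \<sim>[at_top] (\<lambda>r. sqrt (lam \<epsilon> r / ln (real d))) \<and>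
        (\<lambda>r. m_star d \<epsilon> r) \<sim>[at_top]
          (\<lambda>r. r * sqrt (ln (real d) / lam \<epsilon> r) * exp (sqrt (lam \<epsilon> r * ln (real d))))) \<and>
     (\<forall>r>0.
        (\<lambda>\<epsilon>. N_star d \<epsilon> r) \<sim>[at_right 0] (\<lambda>\<epsilon>. sqrt (lam \<epsilon> r / ln (real d))) \<and>
        (\<lambda>\<epsilon>. m_star d \<epsilon> r) \<sim>[at_right 0]
          (\<lambda>\<epsilon>. r * sqrt (ln (real d) / lam \<epsilon> r) * exp (sqrt (lam \<epsilon> r * ln (real d)))))"
proof (intro conjI allI impI)
  fix r \<epsilon> :: real assume "0 < r \<and> 0 < \<epsilon> \<and> \<epsilon> \<le> r * exp r"
  then show "\<exists>!p. is_optimal d \<epsilon> r p"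
    using N_star_m_star(1)[OF assms] by blast
next
  fix \<epsilon> :: real assume "\<epsilon> > 0"
  show "strict_mono_on {r. 0 < r \<and> \<epsilon> \<le> r * exp r} (\<lambda>r. N_star d \<epsilon> r)"
  proof (rule strict_mono_onI)
    fix r s assume "r \<in> {r. 0 < r \<and> \<epsilon> \<le> r * exp r}" "s \<in> {r. 0 < r \<and> \<epsilon> \<le> r * exp r}" "r < s"
    then have rs: "0 < r" "\<epsilon> \<le> r * exp r" "0 < s" "\<epsilon> \<le> s * exp s" "r < s" by auto
    then have "r * exp r < s * exp s"
      by (intro mult_strict_mono) auto
    then have "lam \<epsilon> r < lam \<epsilon> s"
      using rs \<open>\<epsilon> > 0\<close> by (simp add: lam_def divide_strict_right_mono)
    then show "N_star d \<epsilon> r < N_star d \<epsilon> s"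
      using N_star_less_iff[OF assms] rs \<open>\<epsilon> > 0\<close> by simp
  qed
next
  fix r :: real assume "r > 0"
  show "strict_antimono_on {\<epsilon>. 0 < \<epsilon> \<and> \<epsilon> \<le> r * exp r} (\<lambda>\<epsilon>. N_star d \<epsilon> r)"
  proof (rule monotone_onI)
    fix \<epsilon> \<delta> assume "\<epsilon> \<in> {\<epsilon>. 0 < \<epsilon> \<and> \<epsilon> \<le> r * exp r}" "\<delta> \<in> {\<epsilon>. 0 < \<epsilon> \<and> \<epsilon> \<le> r * exp r}" "\<epsilon> < \<delta>"
    then have ed: "0 < \<epsilon>" "\<epsilon> \<le> r * exp r" "0 < \<delta>" "\<delta> \<le> r * exp r" "\<epsilon> < \<delta>" by auto
    then have "lam \<delta> r < lam \<epsilon> r"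
      using \<open>r > 0\<close> by (simp add: lam_def divide_strict_left_mono)
    then show "N_star d \<delta> r < N_star d \<epsilon> r"
      using N_star_less_iff[OF assms] ed \<open>r > 0\<close> by simp
  qed
next
  fix \<epsilon> :: real assume "\<epsilon> > 0"
  have ev: "eventually (\<lambda>r::real. 0 < r \<and> 0 < \<epsilon>) at_top"
    using eventually_gt_at_top[of 0] \<open>\<epsilon> > 0\<close> by simp
  have lim: "filterlim (\<lambda>r. lam \<epsilon> r) at_top at_top"
    unfolding lam_def using \<open>\<epsilon> > 0\<close> by real_asymp
  note N_star_m_star_asymp[OF assms ev lim]
  then show "(\<lambda>r. N_star d \<epsilon> r) \<sim>[at_top] (\<lambda>r. sqrt (lam \<epsilon> r / ln (real d)))"
    and "(\<lambda>r. m_star d \<epsilon> r) \<sim>[at_top]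
          (\<lambda>r. r * sqrt (ln (real d) / lam \<epsilon> r) * exp (sqrt (lam \<epsilon> r * ln (real d))))"
    by simp_all
next
  fix r :: real assume "r > 0"
  have ev: "eventually (\<lambda>\<epsilon>::real. 0 < r \<and> 0 < \<epsilon>) (at_right 0)"
    using eventually_at_right_less[of 0] \<open>r > 0\<close> by simp
  have lim: "filterlim (\<lambda>\<epsilon>. lam \<epsilon> r) at_top (at_right 0)"
    unfolding lam_def using \<open>r > 0\<close> by real_asymp
  note N_star_m_star_asymp[OF assms ev lim]
  then show "(\<lambda>\<epsilon>. N_star d \<epsilon> r) \<sim>[at_right 0] (\<lambda>\<epsilon>. sqrt (lam \<epsilon> r / ln (real d)))"
    and "(\<lambda>\<epsilon>. m_star d \<epsilon> r) \<sim>[at_right 0]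
          (\<lambda>\<epsilon>. r * sqrt (ln (real d) / lam \<epsilon> r) * exp (sqrt (lam \<epsilon> r * ln (real d))))"
    by simp_all
qed

end
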